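(* Let $D\geq 1$, let $r_0,r_1\in\mathbb{C}^\times$, let $\rho_-,\rho_+\in\{r_0,r_0^{-1}\}$, and let $c=(c_1,\dots,c_{D-1})$, $s=(s_0,\dots,s_{D-1})$, $\lambda=(\lambda_1,\dots,\lambda_{D-1})$, $\mu=(\mu_0,\dots,\mu_{D-1})$ be tuples of nonzero complex scalars. Then the defining ordered basis $\mathfrak{B}_E=\{b_0,a_1,b_1,\dots,a_{D-1},b_{D-1},a_D\}$ of the $\widetilde{\mathcal H}$-module $E_D=E_D(\rho_-,\rho_+;c,s,\lambda,\mu)$ is an adapted block basis for $E_D$.
   Context: For nonzero $r_0,r_1\in\mathbb{C}$, $\widetilde{\mathcal H}=\widetilde{\mathcal H}(r_0,r_1)$ is the unital associative $\mathbb{C}$-algebra generated by $t_0,u_0,t_1,u_1$ subject to the relations (i) $(t_i-r_i)(t_i-r_i^{-1})=0$ for $i\in\{0,1\}$; (ii) $u_0^2=u_0$; (iii) $u_1^2=0$; (iv) $u_0t_0t_1u_1=0=t_1u_1u_0t_0$. Set $A=u_0t_0$ and $B=t_1u_1$. For a finite-dimensional module $V$ and $\alpha,\beta\in\mathbb{C}$ let $V_{\alpha,\beta}=\{v\in V: Av=\alpha v,\ Bv=\beta v\}$. For a $2D$-dimensional $\widetilde{\mathcal H}$-module $V$ ($D\ge1$), an (even) adapted block basis is an ordered basis $b_0,a_1,b_1,\ldots,a_{D-1},b_{D-1},a_D$ of $V$ for which there are nonzero scalars $\lambda_1,\dots,\lambda_D,\mu_0,\dots,\mu_{D-1}$ such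 that: $a_i\in V_{\lambda_i,0}$ for $1\le i\le D$; $b_i\in V_{0,\mu_i}$ for $0\le i\le D-1$; $t_0$ preserves $\mathbb{C}b_0$ and $\mathbb{C}a_D$; $t_0$ preserves $\mathrm{span}\{a_i,b_i\}$ for $1\le i\le D-1$; $t_1$ preserves $\mathrm{span}\{b_i,a_{i+1}\}$ for $0\le i\le D-1$. Here "$t_i$ preserves $W$" means $t_iW\subseteq W$. For $c,r,s,\lambda,\mu\in\mathbb{C}^{\times}$ put $k(r)=r+r^{-1}$ and $$R(r,\lambda,c)=\begin{pmatrix}k(r)-\lambda^{-1}&-c\lambda^{-1}\\ c^{-1}(\lambda-k(r)+\lambda^{-1})&\lambda^{-1}\end{pmatrix},\quad P(c)=\begin{pmatrix}1&c\\0&0\end{pmatrix},$$ $$S(r,s)=\begin{pmatrix}k(r)&s\\-s^{-1}&0\end{pmatrix},\quad N(s,\mu)=\begin{pmatrix}0&0\\ s^{-1}\mu&0\end{pmatrix}.$$ Matrices act on coordinate column vectors. $E_D(\rho_-,\rho_+;c,s,\lambda,\mu)$ is the $2D$-dimensional $\widetilde{\mathcal H}$-module with ordered basis $\mathfrak{B}_E=\{b_0,a_1,b_1,\dots,a_{D-1},b_{D-1},a_D\}$ on which $t_0,u_0,t_1,u_1$ are represented respectively by $\operatorname{blockdiag}([\rho_-],R_1,\dots,R_{D-1},[\rho_+])$, $\operatorname{blockdiag}([0],P_1,\dots,P_{D-1},[1])$, $\operatorname{blockdiag}(S_0,\dots,S_{D-1})$, $\operatorname{blockdiag}(N_0,\dots,N_{D-1})$,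 where $R_i=R(r_0,\lambda_i,c_i)$, $P_i=P(c_i)$ for $1\le i\le D-1$ and $S_i=S(r_1,s_i)$, $N_i=N(s_i,\mu_i)$ for $0\le i\le D-1$. When $D=1$ the tuples $c,\lambda$ are empty and there are no blocks $R_i,P_i$. *)

theory Defs
  imports
    "HOL-Library.Poly_Mapping"
    "HOL-Algebra.QuotRing"
    "Jordan_Normal_Form.VS_Connect"
begin

section \<open>The algebra\<close>

datatype generator = T0 | U0 | T1 | U1

text \<open>The free monoid, written additively, so that the type \<^typ>\<open>'a \<Rightarrow>\<^sub>0 complex\<close> of the library,
  with its convolution product, is the free unital associative algebra on the generators.\<close>

datatype word = Word (letters: "generator list")

instantiation word :: monoid_add
begin

definition zero_word :: word where
  "0 = Word []"

definition plus_word :: "word \<Rightarrow> word \<Rightarrow> word" where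
  "v + w = Word (letters v @ letters w)"

instance
  by standard (simp_all add: zero_word_def plus_word_def)

end

type_synonym free_alg = "word \<Rightarrow>\<^sub>0 complex"

definition gen :: "generator \<Rightarrow> free_alg" where
  "gen g = Poly_Mapping.single (Word [g]) 1"

definition const :: "complex \<Rightarrow> free_alg" where
  "const z = Poly_Mapping.single 0 z"

definition relators :: "complex \<Rightarrow> complex \<Rightarrow> free_alg set" where
  "relators r0 r1 =
    {(gen T0 - const r0) * (gen T0 - const (inverse r0)),
     (gen T1 - const r1) * (gen T1 - const (inverse r1)),
     gen U0 * gen U0 - gen U0,
     gen U1 * gen U1,
     gen U0 * gen T0 * gen T1 * gen U1,
     gen T1 * gen U1 * gen U0 * gen T0}"

definition rel_ideal :: "complex \<Rightarrow> complex \<Rightarrow> free_alg set" where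
  "rel_ideal r0 r1 = genideal class_ring (relators r0 r1)"

definition H_alg :: "complex \<Rightarrow> complex \<Rightarrow> free_alg set ring" where
  "H_alg r0 r1 = class_ring Quot rel_ideal r0 r1"

definition H_class :: "complex \<Rightarrow> complex \<Rightarrow> free_alg \<Rightarrow> free_alg set" where
  "H_class r0 r1 p = rel_ideal r0 r1 +>\<^bsub>class_ring\<^esub> p"

definition H_gen :: "complex \<Rightarrow> complex \<Rightarrow> generator \<Rightarrow> free_alg set" where
  "H_gen r0 r1 g = H_class r0 r1 (gen g)"

definition H_A :: "complex \<Rightarrow> complex \<Rightarrow> free_alg set" where
  "H_A r0 r1 = H_gen r0 r1 U0 \<otimes>\<^bsub>H_alg r0 r1\<^esub> H_gen r0 r1 T0"

definition H_B :: "complex \<Rightarrow> complex \<Rightarrow> free_alg set" where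
  "H_B r0 r1 = H_gen r0 r1 T1 \<otimes>\<^bsub>H_alg r0 r1\<^esub> H_gen r0 r1 U1"


section \<open>Modules and adapted block bases\<close>

text \<open>A left module over the algebra: a complex vector space with a unital action of the algebra
  whose restriction to the scalars is the given scalar multiplication.\<close>

definition H_module ::
  "complex \<Rightarrow> complex \<Rightarrow> (complex, 'v, 'm) module_scheme \<Rightarrow> (free_alg set \<Rightarrow> 'v \<Rightarrow> 'v) \<Rightarrow> bool"
where
  "H_module r0 r1 V act \<longleftrightarrow>
     vectorspace class_ring V \<and>
     (\<forall>h\<in>carrier (H_alg r0 r1). \<forall>v\<in>carrier V. act h v \<in> carrier V) \<and>
     (\<forall>h\<in>carrier (H_alg r0 r1). \<forall>v\<in>carrier V. \<forall>w\<in>carrier V.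
        act h (v \<oplus>\<^bsub>V\<^esub> w) = act h v \<oplus>\<^bsub>V\<^esub> act h w) \<and>
     (\<forall>g\<in>carrier (H_alg r0 r1). \<forall>h\<in>carrier (H_alg r0 r1). \<forall>v\<in>carrier V.
        act (g \<oplus>\<^bsub>H_alg r0 r1\<^esub> h) v = act g v \<oplus>\<^bsub>V\<^esub> act h v) \<and>
     (\<forall>g\<in>carrier (H_alg r0 r1). \<forall>h\<in>carrier (H_alg r0 r1). \<forall>v\<in>carrier V.
        act (g \<otimes>\<^bsub>H_alg r0 r1\<^esub> h) v = act g (act h v)) \<and>
     (\<forall>v\<in>carrier V. act \<one>\<^bsub>H_alg r0 r1\<^esub> v = v) \<and>
     (\<forall>z. \<forall>v\<in>carrier V. act (H_class r0 r1 (const z)) v = z \<odot>\<^bsub>V\<^esub> v)"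

definition weight_space ::
  "complex \<Rightarrow> complex \<Rightarrow> (complex, 'v, 'm) module_scheme \<Rightarrow> (free_alg set \<Rightarrow> 'v \<Rightarrow> 'v) \<Rightarrow>
    complex \<Rightarrow> complex \<Rightarrow> 'v set"
where
  "weight_space r0 r1 V act \<alpha> \<beta> =
     {v \<in> carrier V. act (H_A r0 r1) v = \<alpha> \<odot>\<^bsub>V\<^esub> v \<and> act (H_B r0 r1) v = \<beta> \<odot>\<^bsub>V\<^esub> v}"

abbreviation cspan :: "(complex, 'v, 'm) module_scheme \<Rightarrow> 'v set \<Rightarrow> 'v set" where
  "cspan V \<equiv> LinearCombinations.module.span class_ring V"

definition preserves :: "(free_alg set \<Rightarrow> 'v \<Rightarrow> 'v) \<Rightarrow> free_alg set \<Rightarrow> 'v set \<Rightarrow> bool" where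
  "preserves act h W \<longleftrightarrow> act h ` W \<subseteq> W"

text \<open>An ordered basis \<open>b\<^sub>0, a\<^sub>1, b\<^sub>1, \<dots>, a\<^bsub>D-1\<^esub>, b\<^bsub>D-1\<^esub>, a\<^sub>D\<close> is the list \<open>bs\<close>, indexed from 0, so
  \<open>b\<^sub>i\<close> is at position \<open>2i\<close> and \<open>a\<^sub>i\<close> at position \<open>2i - 1\<close>.\<close>

definition adapted_block_basis ::
  "complex \<Rightarrow> complex \<Rightarrow> (complex, 'v, 'm) module_scheme \<Rightarrow> (free_alg set \<Rightarrow> 'v \<Rightarrow> 'v) \<Rightarrow>
    nat \<Rightarrow> 'v list \<Rightarrow> bool"
where
  "adapted_block_basis r0 r1 V act D bs \<longleftrightarrow>
     H_module r0 r1 V act \<and> D \<ge> 1 \<and>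
     vectorspace.fin_dim class_ring V \<and> vectorspace.dim class_ring V = 2 * D \<and>
     length bs = 2 * D \<and> distinct bs \<and> vectorspace.basis class_ring V (set bs) \<and>
     (let a = (\<lambda>i. bs ! (2 * i - 1)); b = (\<lambda>i. bs ! (2 * i));
          t0 = H_gen r0 r1 T0; t1 = H_gen r0 r1 T1
      in \<exists>lam mu :: nat \<Rightarrow> complex.
        (\<forall>i\<in>{1..D}. lam i \<noteq> 0 \<and> a i \<in> weight_space r0 r1 V act (lam i) 0) \<and>
        (\<forall>i\<in>{0..D-1}. mu i \<noteq> 0 \<and> b i \<in> weight_space r0 r1 V act 0 (mu i)) \<and>
        preserves act t0 (cspan V {b 0}) \<and>
        preserves act t0 (cspan V {a D}) \<and>
        (\<forall>i\<in>{1..D-1}. preserves act t0 (cspan V {a i, b i})) \<and>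
        (\<forall>i\<in>{0..D-1}. preserves act t1 (cspan V {b i, a (i + 1)})))"


section \<open>The module \<open>E\<^sub>D\<close>\<close>

definition k_sum :: "complex \<Rightarrow> complex" where
  "k_sum r = r + inverse r"

definition R_mat :: "complex \<Rightarrow> complex \<Rightarrow> complex \<Rightarrow> complex mat" where
  "R_mat r l c = mat_of_rows_list 2
     [[k_sum r - inverse l, - c * inverse l],
      [inverse c * (l - k_sum r + inverse l), inverse l]]"

definition P_mat :: "complex \<Rightarrow> complex mat" where
  "P_mat c = mat_of_rows_list 2 [[1, c], [0, 0]]"

definition S_mat :: "complex \<Rightarrow> complex \<Rightarrow> complex mat" where
  "S_mat r s = mat_of_rows_list 2 [[k_sum r, s], [- inverse s, 0]]"

definition N_mat :: "complex \<Rightarrow> complex \<Rightarrow> complex mat" where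
  "N_mat s m = mat_of_rows_list 2 [[0, 0], [inverse s * m, 0]]"

abbreviation scalar_block :: "complex \<Rightarrow> complex mat" where
  "scalar_block z \<equiv> mat_of_rows_list 1 [[z]]"

fun E_gen_mat ::
  "complex \<Rightarrow> complex \<Rightarrow> nat \<Rightarrow> complex \<Rightarrow> complex \<Rightarrow>
    (nat \<Rightarrow> complex) \<Rightarrow> (nat \<Rightarrow> complex) \<Rightarrow> (nat \<Rightarrow> complex) \<Rightarrow> (nat \<Rightarrow> complex) \<Rightarrow>
    generator \<Rightarrow> complex mat"
where
  "E_gen_mat r0 r1 D \<rho>m \<rho>p c s lam mu T0 =
     diag_block_mat ([scalar_block \<rho>m] @ map (\<lambda>i. R_mat r0 (lam i) (c i)) [1..<D] @ [scalar_block \<rho>p])"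
| "E_gen_mat r0 r1 D \<rho>m \<rho>p c s lam mu U0 =
     diag_block_mat ([scalar_block 0] @ map (\<lambda>i. P_mat (c i)) [1..<D] @ [scalar_block 1])"
| "E_gen_mat r0 r1 D \<rho>m \<rho>p c s lam mu T1 =
     diag_block_mat (map (\<lambda>i. S_mat r1 (s i)) [0..<D])"
| "E_gen_mat r0 r1 D \<rho>m \<rho>p c s lam mu U1 =
     diag_block_mat (map (\<lambda>i. N_mat (s i) (mu i)) [0..<D])"

definition word_mat :: "nat \<Rightarrow> (generator \<Rightarrow> complex mat) \<Rightarrow> word \<Rightarrow> complex mat" where
  "word_mat n G w = foldr (\<lambda>g M. G g * M) (letters w) (1\<^sub>m n)"

text \<open>The algebra homomorphism from the free algebra to the \<open>n \<times> n\<close> matrices that sends each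
  generator \<open>g\<close> to \<open>G g\<close>; the sum of matrices is written out entrywise.\<close>

definition free_eval :: "nat \<Rightarrow> (generator \<Rightarrow> complex mat) \<Rightarrow> free_alg \<Rightarrow> complex mat" where
  "free_eval n G p =
     mat n n (\<lambda>(i, j). \<Sum>w\<in>Poly_Mapping.keys p. Poly_Mapping.lookup p w * word_mat n G w $$ (i, j))"

lemma free_eval_gen:
  assumes "G g \<in> carrier_mat n n"
  shows "free_eval n G (gen g) = G g"
  using assms by (intro eq_matI) (auto simp: free_eval_def gen_def word_mat_def)

definition E_space :: "nat \<Rightarrow> (complex, complex vec) module" where
  "E_space D = module_vec TYPE(complex) (2 * D)"

text \<open>An element of the algebra is a coset of the ideal of relations; it acts by the common value
  of \<^const>\<open>free_eval\<close> on that coset. When the matrices \<^const>\<open>E_gen_mat\<close> satisfy the relations,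
  this value is well defined and each generator acts by its matrix on column vectors.\<close>

definition E_act ::
  "complex \<Rightarrow> complex \<Rightarrow> nat \<Rightarrow> complex \<Rightarrow> complex \<Rightarrow>
    (nat \<Rightarrow> complex) \<Rightarrow> (nat \<Rightarrow> complex) \<Rightarrow> (nat \<Rightarrow> complex) \<Rightarrow> (nat \<Rightarrow> complex) \<Rightarrow>
    free_alg set \<Rightarrow> complex vec \<Rightarrow> complex vec"
where
  "E_act r0 r1 D \<rho>m \<rho>p c s lam mu h v =
     the_elem (free_eval (2 * D) (E_gen_mat r0 r1 D \<rho>m \<rho>p c s lam mu) ` h) *\<^sub>v v"

definition E_basis :: "nat \<Rightarrow> complex vec list" where
  "E_basis D = unit_vecs (2 * D)"

end

theory Submission
  imports Defs
begin

text \<open>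
  Two different block structures on the same basis carry the argument. The matrices of \<open>t\<^sub>0\<close> and
  \<open>u\<^sub>0\<close> are cut into blocks along \<open>b\<^sub>0 | a\<^sub>1, b\<^sub>1 | \<dots> | a\<^bsub>D-1\<^esub>, b\<^bsub>D-1\<^esub> | a\<^sub>D\<close>, those of \<open>t\<^sub>1\<close> and
  \<open>u\<^sub>1\<close> along \<open>b\<^sub>0, a\<^sub>1 | b\<^sub>1, a\<^sub>2 | \<dots> | b\<^bsub>D-1\<^esub>, a\<^sub>D\<close>. The invariant lines and planes of an adapted
  block basis are the spans of these blocks. On the blocks, \<open>P R = diag(\<lambda>, 0)\<close> and
  \<open>S N = diag(\<mu>, 0)\<close>. Since the first vector is \<open>a\<^sub>i\<close> in one cutting and \<open>b\<^sub>i\<close> in the other,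
  \<open>A = u\<^sub>0 t\<^sub>0\<close> is diagonal and kills every \<open>b\<^sub>i\<close>, while \<open>B = t\<^sub>1 u\<^sub>1\<close> is diagonal and kills every
  \<open>a\<^sub>i\<close> (\<open>A_a\<close>, \<open>A_b\<close>, \<open>B_a\<close>, \<open>B_b\<close>). These four facts give the weights; the last eigenvalue is
  \<open>\<lambda>\<^sub>D = \<rho>\<^sub>+\<close>, because \<open>t\<^sub>0\<close> has the one-dimensional block \<open>\<rho>\<^sub>+\<close> at \<open>a\<^sub>D\<close> and \<open>u\<^sub>0\<close> has \<open>1\<close> there.

  An adapted block basis presupposes a module, so the relations have to be verified too. The blocks
  \<open>R\<close> and \<open>S\<close> have trace \<open>r + inverse r\<close> and determinant \<open>1\<close>, so the quadratic relations are the theorem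
  of Cayley and Hamilton on each plane (\<open>quadratic_on_invariant_pair\<close>); on the two lines they hold
  because \<open>\<rho>\<^sub>-\<close> and \<open>\<rho>\<^sub>+\<close> are roots. The relations \<open>A B = 0 = B A\<close> are immediate, as \<open>A\<close> and \<open>B\<close> are
  diagonal with disjoint supports. Evaluation at matrices is a homomorphism on the free algebra, so
  its kernel is an ideal; once that kernel contains the relators it contains the ideal that they
  generate, evaluation is constant on cosets, and the quotient algebra acts
  (\<open>H_module_coset_act\<close>).
\<close>

section \<open>Evaluation of the free algebra at matrices\<close>

text \<open>Elements of the free algebra are finite sums of monomials, so an additive statement about
  them needs to be checked on monomials only.\<close>

lemma free_alg_induct [case_names zero single add]:
  fixes p :: free_alg
  assumes zero: "P 0"
    and single: "\<And>w z. P (Poly_Mapping.single w z)"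
    and add: "\<And>p q. P p \<Longrightarrow> P q \<Longrightarrow> P (p + q)"
  shows "P p"
proof (induction p rule: Poly_Mapping.update_induct)
  case const
  show ?case by (rule zero)
next
  case (update f a b)
  have "Poly_Mapping.update a b f = f + Poly_Mapping.single a b"
    using \<open>a \<notin> Poly_Mapping.keys f\<close>
    by (intro poly_mapping_eqI)
      (auto simp: Poly_Mapping.lookup_update lookup_add lookup_single in_keys_iff when_def)
  then show ?case
    using add[OF update(3) single[of a b]] by simp
qed

locale generator_matrices =
  fixes n :: nat and G :: "generator \<Rightarrow> complex mat"
  assumes gen_carrier [simp]: "G g \<in> carrier_mat n n"
begin

lemma word_mat_carrier [simp]: "word_mat n G w \<in> carrier_mat n n"
proof -
  have "foldr (\<lambda>g M. G g * M) gs (1\<^sub>m n) \<in> carrier_mat n n" for gs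
    by (induction gs) (auto intro: mult_carrier_mat[of _ n n])
  then show ?thesis by (simp add: word_mat_def)
qed

lemma word_mat_plus: "word_mat n G (v + w) = word_mat n G v * word_mat n G w"
proof -
  have "foldr (\<lambda>g M. G g * M) gs (word_mat n G w)
      = foldr (\<lambda>g M. G g * M) gs (1\<^sub>m n) * word_mat n G w" for gs
  proof (induction gs)
    case Nil
    show ?case using left_mult_one_mat[OF word_mat_carrier] by simp
  next
    case (Cons g gs)
    have "foldr (\<lambda>g M. G g * M) gs (1\<^sub>m n) \<in> carrier_mat n n"
      using word_mat_carrier[of "Word gs"] by (simp add: word_mat_def)
    with Cons show ?case
      by (simp add: assoc_mult_mat[OF gen_carrier _ word_mat_carrier])
  qed
  then show ?thesis by (simp add: word_mat_def plus_word_def)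
qed

lemma free_eval_carrier [simp]: "free_eval n G p \<in> carrier_mat n n"
  by (simp add: free_eval_def)

lemma free_eval_dim [simp]: "dim_row (free_eval n G p) = n" "dim_col (free_eval n G p) = n"
  by (simp_all add: free_eval_def)

lemma free_eval_index:
  assumes "finite K" "Poly_Mapping.keys p \<subseteq> K" "i < n" "j < n"
  shows "free_eval n G p $$ (i, j) =
    (\<Sum>w\<in>K. Poly_Mapping.lookup p w * word_mat n G w $$ (i, j))"
  using assms
  by (auto simp: free_eval_def in_keys_iff intro!: sum.mono_neutral_left)

lemma free_eval_zero: "free_eval n G 0 = 0\<^sub>m n n"
  by (intro eq_matI) (auto simp: free_eval_def)

lemma free_eval_single: "free_eval n G (Poly_Mapping.single w z) = z \<cdot>\<^sub>m word_mat n G w"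
  using carrier_matD[OF word_mat_carrier[of w]]
  by (intro eq_matI) (auto simp: free_eval_def)

lemma free_eval_add: "free_eval n G (p + q) = free_eval n G p + free_eval n G q"
proof (intro eq_matI)
  fix i j assume ij: "i < dim_row (free_eval n G p + free_eval n G q)"
    "j < dim_col (free_eval n G p + free_eval n G q)"
  let ?K = "Poly_Mapping.keys p \<union> Poly_Mapping.keys q"
  have "Poly_Mapping.keys (p + q) \<subseteq> ?K" by (rule keys_add)
  with ij show "free_eval n G (p + q) $$ (i, j) = (free_eval n G p + free_eval n G q) $$ (i, j)"
    by (simp add: free_eval_index[of ?K] lookup_add ring_distribs sum.distrib)
qed auto

text \<open>Both sides are additive in \<open>p\<close> and in \<open>q\<close>, which reduces the claim to monomials, where it is
  the rule for concatenated words.\<close>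

lemma free_eval_mult: "free_eval n G (p * q) = free_eval n G p * free_eval n G q"
proof (induction p rule: free_alg_induct)
  case zero
  show ?case using left_mult_zero_mat[OF free_eval_carrier] by (simp add: free_eval_zero)
next
  case (single v y)
  show ?case
  proof (induction q rule: free_alg_induct)
    case zero
    show ?case using right_mult_zero_mat[OF free_eval_carrier] by (simp add: free_eval_zero)
  next
    case (single w z)
    show ?case
      by (simp add: mult_single free_eval_single word_mat_plus mult_smult_assoc_mat[of _ n n _ n]
          mult_smult_distrib[of _ n n _ n])
        (intro eq_matI; simp)
  next
    case (add p q)
    then show ?case
      by (simp add: distrib_left free_eval_add mult_add_distrib_mat[of _ n n _ n])
  qed
next
  case (add p q)
  then show ?case
    by (simp add: distrib_right free_eval_add add_mult_distrib_mat[of _ n n _ _ n])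
qed

lemma free_eval_const: "free_eval n G (const z) = z \<cdot>\<^sub>m 1\<^sub>m n"
  by (simp add: const_def free_eval_single word_mat_def zero_word_def)

lemma free_eval_gen [simp]: "free_eval n G (gen g) = G g"
  by (rule Defs.free_eval_gen) simp

lemma free_eval_uminus: "free_eval n G (- p) = - free_eval n G p"
proof -
  \<comment> \<open>Negation is multiplication by a scalar, which evaluation is already known to respect.\<close>
  have "- p = const (-1) * p"
    by (simp add: const_def single_uminus)
  then show ?thesis
    by (auto simp: free_eval_mult free_eval_const mult_smult_assoc_mat[of _ n n _ n])
qed

lemma free_eval_diff: "free_eval n G (p - q) = free_eval n G p - free_eval n G q"
  using free_eval_add[of p "- q"] by (auto simp: free_eval_uminus)

lemma ideal_free_eval_kernel: "ideal {p. free_eval n G p = 0\<^sub>m n n} class_ring"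
proof (rule idealI[OF class_ring.ring_axioms], goal_cases)
  case 1
  show ?case
  proof (rule group.subgroupI[OF abelian_group.a_group[OF ring.is_abelian_group[OF class_ring.ring_axioms]]], goal_cases)
    case (3 p)
    have "a_inv class_ring p = - p"
      by (simp add: class_ring_simps)
    moreover have "- 0\<^sub>m n n = (0\<^sub>m n n :: complex mat)"
      by (intro eq_matI) auto
    ultimately show ?case
      using 3 by (simp add: a_inv_def free_eval_uminus)
  qed (auto simp: free_eval_zero free_eval_add intro!: exI[of _ 0])
qed (auto simp: free_eval_mult)

end

section \<open>Modules from matrices that satisfy the relations\<close>

locale relation_matrices = generator_matrices +
  fixes r0 r1 :: complex
  assumes free_eval_relator: "p \<in> relators r0 r1 \<Longrightarrow> free_eval n G p = 0\<^sub>m n n"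
begin

definition coset_act :: "free_alg set \<Rightarrow> complex vec \<Rightarrow> complex vec" where
  "coset_act h v = the_elem (free_eval n G ` h) *\<^sub>v v"

lemma ideal_rel_ideal: "ideal (rel_ideal r0 r1) class_ring"
  unfolding rel_ideal_def by (rule ring.genideal_ideal[OF class_ring.ring_axioms]) simp

text \<open>This is the well-definedness of the action: the kernel of evaluation is an ideal that contains
  the relators, hence the whole ideal of relations, so evaluation takes a single value on a coset.\<close>

lemma coset_act_class: "coset_act (H_class r0 r1 p) v = free_eval n G p *\<^sub>v v"
proof -
  interpret I: ideal "rel_ideal r0 r1" class_ring by (rule ideal_rel_ideal)
  have "rel_ideal r0 r1 \<subseteq> {p. free_eval n G p = 0\<^sub>m n n}"
    unfolding rel_ideal_def
    by (rule ring.genideal_minimal[OF class_ring.ring_axioms ideal_free_eval_kernel]) (auto intro: free_eval_relator)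
  moreover have "0 \<in> rel_ideal r0 r1"
    using I.zero_closed by simp
  ultimately have "free_eval n G ` H_class r0 r1 p = {free_eval n G p}"
    by (force simp: H_class_def a_r_coset_def' free_eval_add)
  then show ?thesis by (simp add: coset_act_def)
qed

lemma carrier_H_alg: "carrier (H_alg r0 r1) = range (H_class r0 r1)"
  by (auto simp: H_alg_def FactRing_def A_RCOSETS_def' H_class_def)

lemma H_class_add: "H_class r0 r1 p \<oplus>\<^bsub>H_alg r0 r1\<^esub> H_class r0 r1 q = H_class r0 r1 (p + q)"
  using ideal.a_rcos_sum[OF ideal_rel_ideal, of p q]
  by (simp add: H_alg_def FactRing_def H_class_def)

lemma H_class_mult: "H_class r0 r1 p \<otimes>\<^bsub>H_alg r0 r1\<^esub> H_class r0 r1 q = H_class r0 r1 (p * q)"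
  using ideal.rcoset_mult_add[OF ideal_rel_ideal, of p q]
  by (simp add: H_alg_def FactRing_def H_class_def)

lemma H_class_one: "\<one>\<^bsub>H_alg r0 r1\<^esub> = H_class r0 r1 (const 1)"
  by (simp add: H_alg_def FactRing_def H_class_def const_def)

lemma H_module_coset_act: "H_module r0 r1 (module_vec TYPE(complex) n) coset_act"
  unfolding H_module_def carrier_H_alg
  by (auto simp: vec_vs module_vec_simps coset_act_class H_class_add H_class_mult H_class_one
      free_eval_add free_eval_mult free_eval_const mult_add_distrib_mat_vec[of _ n n]
      add_mult_distrib_mat_vec[of _ n n] assoc_mult_mat_vec[of _ n n _ n]
      intro!: mult_mat_vec_carrier[of _ n n])

lemma coset_act_gen: "coset_act (H_gen r0 r1 g) v = G g *\<^sub>v v"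
  by (simp add: H_gen_def coset_act_class)

lemma coset_act_A: "coset_act (H_A r0 r1) v = G U0 * G T0 *\<^sub>v v"
  by (simp add: H_A_def H_gen_def H_class_mult coset_act_class free_eval_mult)

lemma coset_act_B: "coset_act (H_B r0 r1) v = G T1 * G U1 *\<^sub>v v"
  by (simp add: H_B_def H_gen_def H_class_mult coset_act_class free_eval_mult)

text \<open>The vectors that a generator sends into the span of \<open>S\<close> form a subspace. If it contains
  \<open>S\<close>, it contains the span, so invariance of a span can be tested on spanning vectors.\<close>

lemma preserves_span:
  assumes S: "S \<subseteq> carrier_vec n"
    and gen: "\<And>v. v \<in> S \<Longrightarrow> G g *\<^sub>v v \<in> cspan (module_vec TYPE(complex) n) S"
  shows "preserves coset_act (H_gen r0 r1 g) (cspan (module_vec TYPE(complex) n) S)"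
proof -
  interpret V: vec_space "TYPE(complex)" n .
  let ?W = "{v \<in> carrier_vec n. G g *\<^sub>v v \<in> V.span S}"
  have "submodule class_ring ?W (module_vec TYPE(complex) n)"
  proof (unfold submodule_def, intro conjI allI impI)
    show "module class_ring (module_vec TYPE(complex) n)" by (rule vec_module)
    have "G g *\<^sub>v 0\<^sub>v n = 0\<^sub>v n"
      by (auto intro!: eq_vecI simp: carrier_matD[OF gen_carrier])
    then show "\<zero>\<^bsub>module_vec TYPE(complex) n\<^esub> \<in> ?W"
      using V.span_zero by (simp add: module_vec_simps)
  qed (use S in \<open>auto simp: module_vec_simps mult_add_distrib_mat_vec[OF gen_carrier]
      mult_mat_vec[OF gen_carrier] intro: V.span_add1[simplified] V.smult_in_span\<close>)
  then have "V.span S \<subseteq> ?W"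
    by (rule V.span_is_subset[rotated]) (use S gen in auto)
  then show ?thesis
    by (auto simp: preserves_def coset_act_gen)
qed

end

section \<open>Block diagonal matrices acting on unit vectors\<close>

lemma mult_mat_unit_vec:
  fixes M :: "'a :: comm_semiring_1 mat"
  assumes "M \<in> carrier_mat m n" "k < n"
  shows "M *\<^sub>v unit_vec n k = col M k"
  using assms by (intro eq_vecI) auto

text \<open>A column that passes through the block \<open>B\<close> vanishes outside the rows of \<open>B\<close>. Splitting the list
  of blocks at \<open>B\<close> avoids any formula for the entries of the whole matrix, so that the two cuttings
  of the basis, with their different offsets, are covered by one lemma.\<close>

lemma diag_block_mat_mult_unit_vec:
  fixes B :: "'a :: comm_semiring_1 mat"
  assumes sq: "\<And>C. C \<in> set As \<union> set Bs \<Longrightarrow> square_mat C" and B: "B \<in> carrier_mat m m"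
    and N: "N = sum_list (map dim_row (As @ B # Bs))"
    and off: "off = sum_list (map dim_row As)" and j: "j < m"
  shows "diag_block_mat (As @ B # Bs) *\<^sub>v unit_vec N (off + j) =
    vec N (\<lambda>x. if x \<in> {off..<off + m} then B $$ (x - off, j) else 0)"
proof -
  have "square_mat (diag_block_mat As)"
    by (rule diag_block_mat_square) (use sq in auto)
  moreover have "square_mat (diag_block_mat Bs)"
    by (rule diag_block_mat_square) (use sq in auto)
  moreover have "square_mat (diag_block_mat (As @ B # Bs))"
    by (rule diag_block_mat_square) (use sq B in auto)
  moreover have "dim_row (diag_block_mat As) = off"
    by (simp add: off dim_diag_block_mat)
  moreover have "dim_row (diag_block_mat (As @ B # Bs)) = N"
    by (simp only: N dim_diag_block_mat)
  moreover have "off + m \<le> N"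
    using B by (simp add: N off)
  ultimately show ?thesis
    using B j
    by (subst mult_mat_unit_vec[of _ N N])
      (auto simp: diag_block_mat_append diag_block_mat.simps Let_def intro!: eq_vecI)
qed

lemma diag_block_mat_mult_unit_vec_1:
  fixes B :: "'a :: comm_semiring_1 mat"
  assumes sq: "\<And>C. C \<in> set As \<union> set Bs \<Longrightarrow> square_mat C" and B: "B \<in> carrier_mat 1 1"
    and N: "N = sum_list (map dim_row (As @ B # Bs))"
    and off: "off = sum_list (map dim_row As)"
  shows "diag_block_mat (As @ B # Bs) *\<^sub>v unit_vec N off = B $$ (0, 0) \<cdot>\<^sub>v unit_vec N off"
  using diag_block_mat_mult_unit_vec[OF sq B N off, of 0] 
  by (auto intro!: eq_vecI simp: unit_vec_def)

lemma diag_block_mat_mult_unit_vec_2: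
  fixes B :: "'a :: comm_semiring_1 mat"
  assumes sq: "\<And>C. C \<in> set As \<union> set Bs \<Longrightarrow> square_mat C" and B: "B \<in> carrier_mat 2 2"
    and N: "N = sum_list (map dim_row (As @ B # Bs))"
    and off: "off = sum_list (map dim_row As)" and j: "j < 2"
  shows "diag_block_mat (As @ B # Bs) *\<^sub>v unit_vec N (off + j) =
    B $$ (0, j) \<cdot>\<^sub>v unit_vec N off + B $$ (1, j) \<cdot>\<^sub>v unit_vec N (off + 1)"
proof -
  have "x = off \<or> x = off + 1" if "x < off + 2" "off \<le> x" for x
    using that by auto
  then show ?thesis
    using diag_block_mat_mult_unit_vec[OF sq B N off j]
    by (auto intro!: eq_vecI simp: unit_vec_def)
qed

section \<open>Quadratic relations on invariant lines and planes\<close>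

lemma smult_one_mult_mat_vec:
  fixes v :: "'a :: comm_semiring_1 vec"
  assumes "v \<in> carrier_vec n"
  shows "(z \<cdot>\<^sub>m 1\<^sub>m n) *\<^sub>v v = z \<cdot>\<^sub>v v"
  using assms by (intro eq_vecI) auto

lemma shift_mult_mat_vec:
  fixes v :: "'a :: comm_ring_1 vec"
  assumes "M \<in> carrier_mat n n" "v \<in> carrier_vec n"
  shows "(M - z \<cdot>\<^sub>m 1\<^sub>m n) *\<^sub>v v = M *\<^sub>v v - z \<cdot>\<^sub>v v"
  using assms by (simp add: minus_mult_distrib_mat_vec[of _ n n] smult_one_mult_mat_vec)

lemma shift_carrier: "M \<in> carrier_mat n n \<Longrightarrow> M - (z :: 'a :: comm_ring_1) \<cdot>\<^sub>m 1\<^sub>m n \<in> carrier_mat n n"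
  by (intro minus_carrier_mat) auto

lemma quadratic_on_eigenvector:
  fixes v :: "'a :: field vec"
  assumes M: "M \<in> carrier_mat n n" and v: "v \<in> carrier_vec n"
    and eig: "M *\<^sub>v v = \<rho> \<cdot>\<^sub>v v" and \<rho>: "\<rho> \<in> {r, r'}"
  shows "(M - r \<cdot>\<^sub>m 1\<^sub>m n) * (M - r' \<cdot>\<^sub>m 1\<^sub>m n) *\<^sub>v v = 0\<^sub>v n"
proof -
  have shift: "(M - z \<cdot>\<^sub>m 1\<^sub>m n) *\<^sub>v (y \<cdot>\<^sub>v v) = (y * (\<rho> - z)) \<cdot>\<^sub>v v" for y z
    using M v by (simp add: shift_mult_mat_vec mult_mat_vec[OF M v] eig)
      (auto intro!: eq_vecI simp: algebra_simps)
  from shift[of r' 1] shift[of r "\<rho> - r'"] \<rho> M v show ?thesis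
    by (auto simp: assoc_mult_mat_vec[OF shift_carrier shift_carrier] intro!: eq_vecI)
qed

text \<open>The theorem of Cayley and Hamilton for the matrix \<open>((x, x'), (y, y'))\<close>: by the assumptions on
  trace and determinant its characteristic polynomial is \<open>(X - r) (X - r')\<close>.\<close>

lemma quadratic_on_invariant_pair_fst:
  fixes v w :: "'a :: field vec"
  assumes M: "M \<in> carrier_mat n n" and v: "v \<in> carrier_vec n" and w: "w \<in> carrier_vec n"
    and Mv: "M *\<^sub>v v = x \<cdot>\<^sub>v v + y \<cdot>\<^sub>v w" and Mw: "M *\<^sub>v w = x' \<cdot>\<^sub>v v + y' \<cdot>\<^sub>v w"
    and trace: "x + y' = r + r'" and det: "x * y' - y * x' = r * r'"
  shows "(M - r \<cdot>\<^sub>m 1\<^sub>m n) * (M - r' \<cdot>\<^sub>m 1\<^sub>m n) *\<^sub>v v = 0\<^sub>v n"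
proof -
  have r': "r' = x + y' - r"
    using trace by (simp add: algebra_simps)
  have shift: "(M - z \<cdot>\<^sub>m 1\<^sub>m n) *\<^sub>v (p \<cdot>\<^sub>v v + q \<cdot>\<^sub>v w) =
      (p * (x - z) + q * x') \<cdot>\<^sub>v v + (p * y + q * (y' - z)) \<cdot>\<^sub>v w" for p q z
    using M v w
    by (simp add: shift_mult_mat_vec mult_add_distrib_mat_vec[OF M] mult_mat_vec[OF M] Mv Mw)
      (auto intro!: eq_vecI simp: algebra_simps)
  have "v = 1 \<cdot>\<^sub>v v + 0 \<cdot>\<^sub>v w"
    using v w by (auto intro!: eq_vecI)
  then have "(M - r' \<cdot>\<^sub>m 1\<^sub>m n) *\<^sub>v v = (x - r') \<cdot>\<^sub>v v + y \<cdot>\<^sub>v w"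
    using shift[of r' 1 0] by simp
  then have "(M - r \<cdot>\<^sub>m 1\<^sub>m n) * (M - r' \<cdot>\<^sub>m 1\<^sub>m n) *\<^sub>v v =
      ((x - r') * (x - r) + y * x') \<cdot>\<^sub>v v + ((x - r') * y + y * (y' - r)) \<cdot>\<^sub>v w"
    using M v shift[of r "x - r'" y] by (simp add: assoc_mult_mat_vec[OF shift_carrier shift_carrier])
  moreover have "(x - r') * (x - r) + y * x' = 0"
    using det unfolding r' by (simp add: algebra_simps)
  moreover have "(x - r') * y + y * (y' - r) = 0"
    unfolding r' by (simp add: algebra_simps)
  ultimately show ?thesis
    using v w by (auto intro!: eq_vecI)
qed

lemma quadratic_on_invariant_pair:
  fixes v w :: "'a :: field vec"
  assumes M: "M \<in> carrier_mat n n" and v: "v \<in> carrier_vec n" and w: "w \<in> carrier_vec n"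
    and Mv: "M *\<^sub>v v = x \<cdot>\<^sub>v v + y \<cdot>\<^sub>v w" and Mw: "M *\<^sub>v w = x' \<cdot>\<^sub>v v + y' \<cdot>\<^sub>v w"
    and trace: "x + y' = r + r'" and det: "x * y' - y * x' = r * r'"
  shows "(M - r \<cdot>\<^sub>m 1\<^sub>m n) * (M - r' \<cdot>\<^sub>m 1\<^sub>m n) *\<^sub>v v = 0\<^sub>v n"
    and "(M - r \<cdot>\<^sub>m 1\<^sub>m n) * (M - r' \<cdot>\<^sub>m 1\<^sub>m n) *\<^sub>v w = 0\<^sub>v n"
proof -
  show "(M - r \<cdot>\<^sub>m 1\<^sub>m n) * (M - r' \<cdot>\<^sub>m 1\<^sub>m n) *\<^sub>v v = 0\<^sub>v n"
    by (rule quadratic_on_invariant_pair_fst[OF assms])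
  have "M *\<^sub>v w = y' \<cdot>\<^sub>v w + x' \<cdot>\<^sub>v v" "M *\<^sub>v v = y \<cdot>\<^sub>v w + x \<cdot>\<^sub>v v"
    using Mv Mw v w by (simp_all add: comm_add_vec[of _ n])
  then show "(M - r \<cdot>\<^sub>m 1\<^sub>m n) * (M - r' \<cdot>\<^sub>m 1\<^sub>m n) *\<^sub>v w = 0\<^sub>v n"
    by (rule quadratic_on_invariant_pair_fst[OF M w v])
      (use trace det in \<open>simp_all add: ac_simps\<close>)
qed

section \<open>The action of the generators on the basis\<close>

text \<open>From here on the matrices are used only through their action on basis vectors; unfolding them
  into nested block matrices would hide that action.\<close>

declare diag_block_mat.simps [simp del] E_gen_mat.simps [simp del]

lemma upt_split_at: "k \<le> i \<Longrightarrow> i < j \<Longrightarrow> [k..<j] = [k..<i] @ i # [Suc i..<j]"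
  using upt_add_eq_append[of k i "j - i"] by (simp add: upt_conv_Cons)

locale E_parameters =
  fixes D :: nat and r0 r1 \<rho>m \<rho>p :: complex
    and c s lam mu :: "nat \<Rightarrow> complex"
  assumes D_pos: "D \<ge> 1"
    and r0: "r0 \<noteq> 0" and r1: "r1 \<noteq> 0"
    and \<rho>m: "\<rho>m \<in> {r0, inverse r0}" and \<rho>p: "\<rho>p \<in> {r0, inverse r0}"
    and c: "\<And>i. i \<in> {1..D-1} \<Longrightarrow> c i \<noteq> 0"
    and s: "\<And>i. i \<in> {0..D-1} \<Longrightarrow> s i \<noteq> 0"
    and lam: "\<And>i. i \<in> {1..D-1} \<Longrightarrow> lam i \<noteq> 0"
    and mu: "\<And>i. i \<in> {0..D-1} \<Longrightarrow> mu i \<noteq> 0"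
begin

abbreviation "n \<equiv> 2 * D"
abbreviation "G \<equiv> E_gen_mat r0 r1 D \<rho>m \<rho>p c s lam mu"

text \<open>The index shift follows the order of the basis, which starts with \<open>b\<^sub>0\<close> and has \<open>a\<^sub>i\<close> just
  before \<open>b\<^sub>i\<close>. Only the \<open>a i\<close> with \<open>i \<ge> 1\<close> are basis vectors \<open>a\<^sub>i\<close>: truncated subtraction makes
  \<open>a 0\<close> equal to \<open>b 0\<close>.\<close>

definition a :: "nat \<Rightarrow> complex vec" where "a i = unit_vec n (2 * i - 1)"
definition b :: "nat \<Rightarrow> complex vec" where "b i = unit_vec n (2 * i)"

lemma a_carrier [simp]: "a i \<in> carrier_vec n" and b_carrier [simp]: "b i \<in> carrier_vec n"
  by (simp_all add: a_def b_def)

lemma a_b_dim [simp]: "dim_vec (a i) = n" "dim_vec (b i) = n"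
  by (simp_all add: a_def b_def)

lemma a_b_zero_smult [simp]: "0 \<cdot>\<^sub>v a i = 0\<^sub>v n" "0 \<cdot>\<^sub>v b i = 0\<^sub>v n"
  by (auto intro!: eq_vecI)

lemma smult_zero_vec [simp]: "z \<cdot>\<^sub>v 0\<^sub>v n = (0\<^sub>v n :: complex vec)"
  by (auto intro!: eq_vecI)

lemma zero_mult_mat_a_b [simp]: "0\<^sub>m n n *\<^sub>v a i = 0\<^sub>v n" "0\<^sub>m n n *\<^sub>v b i = 0\<^sub>v n"
  by (auto intro!: eq_vecI)

lemma block_carrier [simp]:
  "R_mat r l d \<in> carrier_mat 2 2" "P_mat d \<in> carrier_mat 2 2"
  "S_mat r d \<in> carrier_mat 2 2" "N_mat d l \<in> carrier_mat 2 2"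
  by (auto simp: R_mat_def P_mat_def S_mat_def N_mat_def mat_of_rows_list_def)

lemma block_index:
  "R_mat r l d $$ (0, 0) = k_sum r - inverse l" "R_mat r l d $$ (0, 1) = - d * inverse l"
  "R_mat r l d $$ (1, 0) = inverse d * (l - k_sum r + inverse l)" "R_mat r l d $$ (1, 1) = inverse l"
  "P_mat d $$ (0, 0) = 1" "P_mat d $$ (0, 1) = d" "P_mat d $$ (1, 0) = 0" "P_mat d $$ (1, 1) = 0"
  "S_mat r d $$ (0, 0) = k_sum r" "S_mat r d $$ (0, 1) = d"
  "S_mat r d $$ (1, 0) = - inverse d" "S_mat r d $$ (1, 1) = 0"
  "N_mat d l $$ (0, 0) = 0" "N_mat d l $$ (0, 1) = 0"
  "N_mat d l $$ (1, 0) = inverse d * l" "N_mat d l $$ (1, 1) = 0"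
  by (simp_all add: R_mat_def P_mat_def S_mat_def N_mat_def mat_of_rows_list_def)

lemma scalar_block_carrier: "scalar_block z \<in> carrier_mat 1 1"
  and scalar_block_index: "scalar_block z $$ (0, 0) = z"
  by (simp_all add: mat_of_rows_list_def)

text \<open>The cutting for \<open>t\<^sub>0\<close> and \<open>u\<^sub>0\<close>: the initial block of size one moves the \<open>i\<close>-th block of size
  two to the offset \<open>2 i - 1\<close>, which is the position of \<open>a\<^sub>i\<close>.\<close>

lemma shifted_blocks_mult:
  assumes F: "\<And>i. F i \<in> carrier_mat 2 2"
    and X: "X \<in> carrier_mat 1 1" and Y: "Y \<in> carrier_mat 1 1"
    and M_def: "M = diag_block_mat ([X] @ map F [1..<D] @ [Y])"
  shows "M *\<^sub>v b 0 = X $$ (0, 0) \<cdot>\<^sub>v b 0"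
    and "M *\<^sub>v a D = Y $$ (0, 0) \<cdot>\<^sub>v a D"
    and "i \<in> {1..<D} \<Longrightarrow> M *\<^sub>v a i = F i $$ (0, 0) \<cdot>\<^sub>v a i + F i $$ (1, 0) \<cdot>\<^sub>v b i"
    and "i \<in> {1..<D} \<Longrightarrow> M *\<^sub>v b i = F i $$ (0, 1) \<cdot>\<^sub>v a i + F i $$ (1, 1) \<cdot>\<^sub>v b i"
    and "M \<in> carrier_mat n n"
proof -
  have F': "dim_row (F i) = 2" "dim_col (F i) = 2" for i using F by blast+
  have X': "dim_row X = 1" "dim_col X = 1" "X \<in> carrier_mat (Suc 0) (Suc 0)" 
    and Y': "dim_row Y = 1" "dim_col Y = 1" "Y \<in> carrier_mat (Suc 0) (Suc 0)" using X Y by auto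
  have dims: "sum_list (map (dim_row \<circ> F) xs) = 2 * length xs" "sum_list (map (dim_col \<circ> F) xs) = 2 * length xs" for xs
    by (simp_all add: F' o_def sum_list_triv)
  have "diag_block_mat ([] @ X # (map F [1..<D] @ [Y])) *\<^sub>v unit_vec n 0 = X $$ (0, 0) \<cdot>\<^sub>v unit_vec n 0"
    by (rule diag_block_mat_mult_unit_vec_1) (use D_pos in \<open>auto simp: F' X' Y' dims\<close>)
  then show "M *\<^sub>v b 0 = X $$ (0, 0) \<cdot>\<^sub>v b 0"
    by (simp add: M_def b_def)
  have "diag_block_mat ((X # map F [1..<D]) @ Y # []) *\<^sub>v unit_vec n (2 * D - 1) =
      Y $$ (0, 0) \<cdot>\<^sub>v unit_vec n (2 * D - 1)"
    by (rule diag_block_mat_mult_unit_vec_1) (use D_pos in \<open>auto simp: F' X' Y' dims\<close>)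
  then show "M *\<^sub>v a D = Y $$ (0, 0) \<cdot>\<^sub>v a D"
    by (simp add: M_def a_def)
  show "M \<in> carrier_mat n n"
    using D_pos by (auto simp: M_def dim_diag_block_mat F' X' Y' dims intro!: carrier_matI)
  assume i: "i \<in> {1..<D}"
  then have split: "[1..<D] = [1..<i] @ i # [Suc i..<D]"
    by (intro upt_split_at) auto
  have "diag_block_mat ((X # map F [1..<i]) @ F i # (map F [Suc i..<D] @ [Y]))
        *\<^sub>v unit_vec n (2 * i - 1 + j) =
      F i $$ (0, j) \<cdot>\<^sub>v unit_vec n (2 * i - 1) + F i $$ (1, j) \<cdot>\<^sub>v unit_vec n (2 * i - 1 + 1)"
    if "j < 2" for j
    by (rule diag_block_mat_mult_unit_vec_2[OF _ F _ _ that]) (use i in \<open>auto simp: F' X' Y' dims\<close>)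
  then have "M *\<^sub>v unit_vec n (2 * i - 1 + j) =
      F i $$ (0, j) \<cdot>\<^sub>v unit_vec n (2 * i - 1) + F i $$ (1, j) \<cdot>\<^sub>v unit_vec n (2 * i - 1 + 1)"
    if "j < 2" for j
    using that unfolding M_def split by simp
  from this[of 0] this[of 1] i show "M *\<^sub>v a i = F i $$ (0, 0) \<cdot>\<^sub>v a i + F i $$ (1, 0) \<cdot>\<^sub>v b i"
    "M *\<^sub>v b i = F i $$ (0, 1) \<cdot>\<^sub>v a i + F i $$ (1, 1) \<cdot>\<^sub>v b i"
    by (simp_all add: a_def b_def)
qed

text \<open>The cutting for \<open>t\<^sub>1\<close> and \<open>u\<^sub>1\<close>: without a block of size one in front, the \<open>i\<close>-th block starts
  at the position \<open>2 i\<close> of \<open>b\<^sub>i\<close>.\<close>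

lemma aligned_blocks_mult:
  assumes F: "\<And>i. F i \<in> carrier_mat 2 2"
    and M_def: "M = diag_block_mat (map F [0..<D])"
  shows "i \<in> {0..D-1} \<Longrightarrow> M *\<^sub>v b i = F i $$ (0, 0) \<cdot>\<^sub>v b i + F i $$ (1, 0) \<cdot>\<^sub>v a (Suc i)"
    and "i \<in> {0..D-1} \<Longrightarrow> M *\<^sub>v a (Suc i) = F i $$ (0, 1) \<cdot>\<^sub>v b i + F i $$ (1, 1) \<cdot>\<^sub>v a (Suc i)"
    and "M \<in> carrier_mat n n"
proof -
  have F': "dim_row (F i) = 2" "dim_col (F i) = 2" for i using F by blast+
  have dims: "sum_list (map (dim_row \<circ> F) xs) = 2 * length xs" "sum_list (map (dim_col \<circ> F) xs) = 2 * length xs" for xs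
    by (simp_all add: F' o_def sum_list_triv)
  show "M \<in> carrier_mat n n"
    using D_pos by (auto simp: M_def dim_diag_block_mat F' dims intro!: carrier_matI)
  assume i: "i \<in> {0..D-1}"
  then have split: "[0..<D] = [0..<i] @ i # [Suc i..<D]" and iD: "i < D"
    using D_pos by (auto intro!: upt_split_at)
  have "diag_block_mat (map F [0..<i] @ F i # map F [Suc i..<D]) *\<^sub>v unit_vec n (2 * i + j) =
      F i $$ (0, j) \<cdot>\<^sub>v unit_vec n (2 * i) + F i $$ (1, j) \<cdot>\<^sub>v unit_vec n (2 * i + 1)"
    if "j < 2" for j
    by (rule diag_block_mat_mult_unit_vec_2[OF _ F _ _ that]) (use iD in \<open>auto simp: F' dims\<close>)
  then have "M *\<^sub>v unit_vec n (2 * i + j) =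
      F i $$ (0, j) \<cdot>\<^sub>v unit_vec n (2 * i) + F i $$ (1, j) \<cdot>\<^sub>v unit_vec n (2 * i + 1)"
    if "j < 2" for j
    using that unfolding M_def split by simp
  from this[of 0] this[of 1] show "M *\<^sub>v b i = F i $$ (0, 0) \<cdot>\<^sub>v b i + F i $$ (1, 0) \<cdot>\<^sub>v a (Suc i)"
    "M *\<^sub>v a (Suc i) = F i $$ (0, 1) \<cdot>\<^sub>v b i + F i $$ (1, 1) \<cdot>\<^sub>v a (Suc i)"
    by (simp_all add: a_def b_def)
qed

lemma T0_mult:
  "G T0 *\<^sub>v b 0 = \<rho>m \<cdot>\<^sub>v b 0"
  "G T0 *\<^sub>v a D = \<rho>p \<cdot>\<^sub>v a D"
  "i \<in> {1..<D} \<Longrightarrow> G T0 *\<^sub>v a i =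
    (k_sum r0 - inverse (lam i)) \<cdot>\<^sub>v a i
    + (inverse (c i) * (lam i - k_sum r0 + inverse (lam i))) \<cdot>\<^sub>v b i"
  "i \<in> {1..<D} \<Longrightarrow> G T0 *\<^sub>v b i = (- c i * inverse (lam i)) \<cdot>\<^sub>v a i + inverse (lam i) \<cdot>\<^sub>v b i"
  "G T0 \<in> carrier_mat n n"
  using shifted_blocks_mult[of "\<lambda>i. R_mat r0 (lam i) (c i)", OF block_carrier(1) scalar_block_carrier
      scalar_block_carrier E_gen_mat.simps(1), unfolded block_index scalar_block_index]
  by (simp_all)

lemma U0_mult:
  "G U0 *\<^sub>v b 0 = 0\<^sub>v n"
  "i \<in> {1..D} \<Longrightarrow> G U0 *\<^sub>v a i = a i"
  "i \<in> {1..<D} \<Longrightarrow> G U0 *\<^sub>v b i = c i \<cdot>\<^sub>v a i"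
  "G U0 \<in> carrier_mat n n"
  using shifted_blocks_mult[of "\<lambda>i. P_mat (c i)", OF block_carrier(2) scalar_block_carrier
      scalar_block_carrier E_gen_mat.simps(2), unfolded block_index scalar_block_index]
  by (cases "i = D"; simp)+

lemma T1_mult:
  "i \<in> {0..D-1} \<Longrightarrow> G T1 *\<^sub>v b i = k_sum r1 \<cdot>\<^sub>v b i + (- inverse (s i)) \<cdot>\<^sub>v a (Suc i)"
  "i \<in> {0..D-1} \<Longrightarrow> G T1 *\<^sub>v a (Suc i) = s i \<cdot>\<^sub>v b i"
  "G T1 \<in> carrier_mat n n"
  using aligned_blocks_mult[of "\<lambda>i. S_mat r1 (s i)", OF block_carrier(3) E_gen_mat.simps(3), unfolded block_index]
  by (simp_all)

lemma U1_mult: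
  "i \<in> {0..D-1} \<Longrightarrow> G U1 *\<^sub>v b i = (inverse (s i) * mu i) \<cdot>\<^sub>v a (Suc i)"
  "i \<in> {0..D-1} \<Longrightarrow> G U1 *\<^sub>v a (Suc i) = 0\<^sub>v n"
  "G U1 \<in> carrier_mat n n"
  using aligned_blocks_mult[of "\<lambda>i. N_mat (s i) (mu i)", OF block_carrier(4) E_gen_mat.simps(4), unfolded block_index]
  by (simp_all)

lemma E_gen_mat_carrier: "G g \<in> carrier_mat n n"
  using T0_mult(5) U0_mult(4) T1_mult(3) U1_mult(3) by (cases g) blast+

sublocale generator_matrices n G
  by standard (rule E_gen_mat_carrier)

text \<open>The scalars \<open>\<lambda>\<^sub>1, \<dots>, \<lambda>\<^sub>D\<close> of the adapted block basis: the parameters of the module supply all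
  but the last, which is the eigenvalue of \<open>t\<^sub>0\<close> at \<open>a\<^sub>D\<close>.\<close>

definition lam_ext :: "nat \<Rightarrow> complex" where
  "lam_ext i = (if i = D then \<rho>p else lam i)"

lemma inner_nonzero: "i \<in> {1..<D} \<Longrightarrow> c i \<noteq> 0" "i \<in> {1..<D} \<Longrightarrow> lam i \<noteq> 0"
proof -
  assume "i \<in> {1..<D}"
  then have "i \<in> {1..D-1}" by auto
  then show "c i \<noteq> 0" "lam i \<noteq> 0" by (rule c, rule lam)
qed

lemma lam_ext_nonzero: "i \<in> {1..D} \<Longrightarrow> lam_ext i \<noteq> 0"
  using inner_nonzero(2)[of i] \<rho>p r0 by (cases "i = D") (auto simp: lam_ext_def)

lemma mult_mat_comb:
  "v \<in> carrier_vec n \<Longrightarrow> w \<in> carrier_vec n \<Longrightarrow>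
    G g *\<^sub>v (x \<cdot>\<^sub>v v + y \<cdot>\<^sub>v w) = x \<cdot>\<^sub>v (G g *\<^sub>v v) + y \<cdot>\<^sub>v (G g *\<^sub>v w)"
  "v \<in> carrier_vec n \<Longrightarrow> G g *\<^sub>v (x \<cdot>\<^sub>v v) = x \<cdot>\<^sub>v (G g *\<^sub>v v)"
  "v \<in> carrier_vec n \<Longrightarrow> G g * G h *\<^sub>v v = G g *\<^sub>v (G h *\<^sub>v v)"
  "G g *\<^sub>v 0\<^sub>v n = 0\<^sub>v n"
  by (simp_all add: mult_add_distrib_mat_vec[OF gen_carrier] mult_mat_vec[OF gen_carrier]
      assoc_mult_mat_vec[OF gen_carrier gen_carrier])
    (auto intro!: eq_vecI simp: carrier_matD[OF gen_carrier])

text \<open>In the first column of \<open>R\<close> the lower entry is chosen so that \<open>c\<close> times it, which is what \<open>P\<close>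
  adds to the upper entry, completes that entry to \<open>\<lambda>\<close>; in the second column, treated in \<open>A_b\<close>,
  the same sum is \<open>0\<close>.\<close>

lemma A_a:
  assumes i: "i \<in> {1..D}"
  shows "G U0 * G T0 *\<^sub>v a i = lam_ext i \<cdot>\<^sub>v a i"
proof (cases "i = D")
  case True
  then show ?thesis
    using D_pos by (simp add: mult_mat_comb T0_mult U0_mult lam_ext_def)
next
  case False
  with i have i': "i \<in> {1..<D}" by auto
  have "k_sum r0 - inverse (lam i)
      + inverse (c i) * (lam i - k_sum r0 + inverse (lam i)) * c i = lam i"
    using inner_nonzero(1)[OF i'] by (simp add: mult.commute[of "inverse (c i)"] mult.assoc)
  then show ?thesis
    using False i
    by (simp add: mult_mat_comb T0_mult(3)[OF i'] U0_mult(2)[OF i] U0_mult(3)[OF i']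
        lam_ext_def smult_smult_assoc flip: add_smult_distrib_vec)
qed

lemma A_b:
  assumes i: "i \<in> {0..D-1}"
  shows "G U0 * G T0 *\<^sub>v b i = 0\<^sub>v n"
proof (cases "i = 0")
  case True
  then show ?thesis
    by (simp add: mult_mat_comb T0_mult U0_mult)
next
  case False
  with i have i': "i \<in> {1..<D}" and i'': "i \<in> {1..D}" by auto
  have "- c i * inverse (lam i) + inverse (lam i) * c i = 0"
    by simp
  then show ?thesis
    by (simp add: mult_mat_comb T0_mult(4)[OF i'] U0_mult(2)[OF i''] U0_mult(3)[OF i']
        smult_smult_assoc flip: add_smult_distrib_vec)
qed

lemma B_b:
  assumes i: "i \<in> {0..D-1}"
  shows "G T1 * G U1 *\<^sub>v b i = mu i \<cdot>\<^sub>v b i"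
proof -
  have "inverse (s i) * mu i * s i = mu i"
    using s[OF i] by simp
  then show ?thesis
    by (simp only: mult_mat_comb T1_mult(1,2)[OF i] U1_mult(1)[OF i] smult_smult_assoc a_carrier b_carrier)
qed

lemma U1_a: "i \<in> {1..D} \<Longrightarrow> G U1 *\<^sub>v a i = 0\<^sub>v n"
  using U1_mult(2)[of "i - 1"] by (auto simp: diff_le_mono)

lemma B_a: "i \<in> {1..D} \<Longrightarrow> G T1 * G U1 *\<^sub>v a i = 0\<^sub>v n"
  by (simp add: mult_mat_comb U1_a)

section \<open>The relations and the adapted block basis\<close>

lemma mat_eq_on_basis:
  assumes M: "M \<in> carrier_mat n n" and N: "N \<in> carrier_mat n n"
    and b: "\<And>i. i \<in> {0..D-1} \<Longrightarrow> M *\<^sub>v b i = N *\<^sub>v b i"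
    and a: "\<And>i. i \<in> {1..D} \<Longrightarrow> M *\<^sub>v a i = N *\<^sub>v a i"
  shows "M = N"
proof -
  have "col M k = col N k" if k: "k < n" for k
  proof (cases "even k")
    case True
    then show ?thesis
      using b[of "k div 2"] k M N by (simp add: b_def mult_mat_unit_vec)
  next
    case False
    then have "k = 2 * Suc (k div 2) - 1" "Suc (k div 2) \<in> {1..D}"
      using k by (auto elim!: oddE)
    then show ?thesis
      using a[of "Suc (k div 2)"] k M N by (simp add: a_def mult_mat_unit_vec)
  qed
  then show ?thesis
    using M N by (intro mat_col_eqI) auto
qed

lemma T0_quadratic:
  "(G T0 - r0 \<cdot>\<^sub>m 1\<^sub>m n) * (G T0 - inverse r0 \<cdot>\<^sub>m 1\<^sub>m n) = 0\<^sub>m n n" (is "?Q = _")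
proof (rule mat_eq_on_basis)
  have trace: "(k_sum r0 - inverse (lam i)) + inverse (lam i) = r0 + inverse r0" for i
    by (simp add: k_sum_def)
  have det: "(k_sum r0 - inverse (lam i)) * inverse (lam i) -
      (inverse (c i) * (lam i - k_sum r0 + inverse (lam i))) * (- c i * inverse (lam i)) =
      r0 * inverse r0" if "i \<in> {1..<D}" for i
    using inner_nonzero[OF that] r0 by (simp add: field_simps)
  note pair = quadratic_on_invariant_pair[OF gen_carrier a_carrier b_carrier T0_mult(3,4) trace det]
  fix i
  show "?Q *\<^sub>v b i = 0\<^sub>m n n *\<^sub>v b i" if "i \<in> {0..D-1}"
  proof (cases "i = 0")
    case True
    show ?thesis
      using quadratic_on_eigenvector[OF gen_carrier b_carrier T0_mult(1) \<rho>m]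
      by (simp add: True)
  next
    case False
    with that have "i \<in> {1..<D}" by auto
    then show ?thesis using pair(2) by simp
  qed
  show "?Q *\<^sub>v a i = 0\<^sub>m n n *\<^sub>v a i" if "i \<in> {1..D}"
  proof (cases "i = D")
    case True
    show ?thesis
      using quadratic_on_eigenvector[OF gen_carrier a_carrier T0_mult(2) \<rho>p]
      by (simp add: True)
  next
    case False
    with that have "i \<in> {1..<D}" by auto
    then show ?thesis using pair(1) by simp
  qed
qed (auto intro!: mult_carrier_mat[of _ n n] shift_carrier)

lemma T1_quadratic:
  "(G T1 - r1 \<cdot>\<^sub>m 1\<^sub>m n) * (G T1 - inverse r1 \<cdot>\<^sub>m 1\<^sub>m n) = 0\<^sub>m n n" (is "?Q = _")
proof (rule mat_eq_on_basis)
  have trace: "k_sum r1 + 0 = r1 + inverse r1"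
    by (simp add: k_sum_def)
  have det: "k_sum r1 * 0 - (- inverse (s i)) * s i = r1 * inverse r1" if "i \<in> {0..D-1}" for i
    using s[OF that] r1 by simp
  have T1_a: "G T1 *\<^sub>v a (Suc i) = s i \<cdot>\<^sub>v b i + 0 \<cdot>\<^sub>v a (Suc i)" if "i \<in> {0..D-1}" for i
    using T1_mult(2)[OF that] by simp
  note block = gen_carrier b_carrier a_carrier T1_mult(1) T1_a trace det
  fix i
  show "?Q *\<^sub>v b i = 0\<^sub>m n n *\<^sub>v b i" if "i \<in> {0..D-1}"
    using quadratic_on_invariant_pair(1)[OF block] that by simp
  show "?Q *\<^sub>v a i = 0\<^sub>m n n *\<^sub>v a i" if "i \<in> {1..D}"
  proof -
    have "?Q *\<^sub>v a (Suc (i - 1)) = 0\<^sub>v n"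
      by (rule quadratic_on_invariant_pair(2)[OF block]) (use that in auto)
    with that show ?thesis by simp
  qed
qed (auto intro!: mult_carrier_mat[of _ n n] shift_carrier)

lemma U0_idempotent: "G U0 * G U0 = G U0"
proof (rule mat_eq_on_basis)
  fix i
  show "G U0 * G U0 *\<^sub>v b i = G U0 *\<^sub>v b i" if "i \<in> {0..D-1}"
    using that by (cases "i = 0") (auto simp: mult_mat_comb U0_mult)
qed (auto simp: mult_mat_comb U0_mult intro!: mult_carrier_mat[of _ n n])

lemma U1_square_zero: "G U1 * G U1 = 0\<^sub>m n n"
  by (rule mat_eq_on_basis)
    (auto simp: mult_mat_comb U1_mult U1_a intro!: mult_carrier_mat[of _ n n])

lemma A_carrier: "G U0 * G T0 \<in> carrier_mat n n" and B_carrier: "G T1 * G U1 \<in> carrier_mat n n"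
  by (auto intro: mult_carrier_mat[of _ n n])

lemma A_B_zero: "(G U0 * G T0) * (G T1 * G U1) = 0\<^sub>m n n"
proof (rule mat_eq_on_basis)
  fix i
  show "(G U0 * G T0) * (G T1 * G U1) *\<^sub>v b i = 0\<^sub>m n n *\<^sub>v b i" if "i \<in> {0..D-1}"
    using A_b[OF that] B_b[OF that]
    by (simp only: assoc_mult_mat_vec[OF A_carrier B_carrier] mult_mat_vec[OF A_carrier] b_carrier)
       simp
  show "(G U0 * G T0) * (G T1 * G U1) *\<^sub>v a i = 0\<^sub>m n n *\<^sub>v a i" if "i \<in> {1..D}"
    using B_a[OF that]
    by (simp only: assoc_mult_mat_vec[OF A_carrier B_carrier] a_carrier)
       (simp add: mult_mat_comb)
qed (auto intro!: mult_carrier_mat[of _ n n])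

lemma B_A_zero: "(G T1 * G U1) * (G U0 * G T0) = 0\<^sub>m n n"
proof (rule mat_eq_on_basis)
  fix i
  show "(G T1 * G U1) * (G U0 * G T0) *\<^sub>v b i = 0\<^sub>m n n *\<^sub>v b i" if "i \<in> {0..D-1}"
    using A_b[OF that]
    by (simp only: assoc_mult_mat_vec[OF B_carrier A_carrier] b_carrier)
       (simp add: mult_mat_comb)
  show "(G T1 * G U1) * (G U0 * G T0) *\<^sub>v a i = 0\<^sub>m n n *\<^sub>v a i" if "i \<in> {1..D}"
    using A_a[OF that] B_a[OF that]
    by (simp only: assoc_mult_mat_vec[OF B_carrier A_carrier] mult_mat_vec[OF B_carrier] a_carrier)
       simp
qed (auto intro!: mult_carrier_mat[of _ n n])

sublocale relation_matrices n G r0 r1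
proof
  fix p assume "p \<in> relators r0 r1"
  then consider "p = (gen T0 - const r0) * (gen T0 - const (inverse r0))"
    | "p = (gen T1 - const r1) * (gen T1 - const (inverse r1))"
    | "p = gen U0 * gen U0 - gen U0"
    | "p = gen U1 * gen U1"
    | "p = (gen U0 * gen T0) * (gen T1 * gen U1)"
    | "p = (gen T1 * gen U1) * (gen U0 * gen T0)"
    by (auto simp: relators_def mult.assoc)
  then show "free_eval n G p = 0\<^sub>m n n"
    by cases
      (simp_all add: free_eval_mult free_eval_diff free_eval_const T0_quadratic T1_quadratic
        U0_idempotent U1_square_zero A_B_zero B_A_zero minus_r_inv_mat[OF gen_carrier])
qed

lemma E_act_eq: "E_act r0 r1 D \<rho>m \<rho>p c s lam mu = coset_act"
  by (intro ext) (simp add: E_act_def coset_act_def)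

lemma adapted_block_basis_E:
  "adapted_block_basis r0 r1 (E_space D) (E_act r0 r1 D \<rho>m \<rho>p c s lam mu) D (E_basis D)"
proof -
  interpret V: vec_space "TYPE(complex)" n .
  \<comment> \<open>The witnesses for the two families of eigenvalues, as a rule that applies after unfolding.\<close>
  have exI2: "P lam_ext mu \<Longrightarrow> \<exists>l m. P l m"
    for P :: "(nat \<Rightarrow> complex) \<Rightarrow> (nat \<Rightarrow> complex) \<Rightarrow> bool"
    by blast
  have a_nth: "E_basis D ! (2 * i - 1) = a i" if "i \<in> {1..D}" for i
    using that by (auto simp: E_basis_def unit_vecs_def a_def)
  have b_nth: "E_basis D ! (2 * i) = b i" if "i \<in> {0..D-1}" for i
    using that D_pos by (auto simp: E_basis_def unit_vecs_def b_def)
  have a_weight: "a i \<in> weight_space r0 r1 (E_space D) coset_act (lam_ext i) 0" if "i \<in> {1..D}" for i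
    using A_a[OF that] B_a[OF that]
    by (simp add: weight_space_def E_space_def module_vec_simps coset_act_A coset_act_B)
  have b_weight: "b i \<in> weight_space r0 r1 (E_space D) coset_act 0 (mu i)" if "i \<in> {0..D-1}" for i
    using A_b[OF that] B_b[OF that]
    by (simp add: weight_space_def E_space_def module_vec_simps coset_act_A coset_act_B)
  have comb: "x \<cdot>\<^sub>v v + y \<cdot>\<^sub>v w \<in> V.span {v, w}"
    if "v \<in> carrier_vec n" "w \<in> carrier_vec n" for v w x y
    using that V.in_own_span[of "{v, w}"]
    by (intro V.span_add1[simplified] V.smult_in_span) auto
  have preserves_line: "preserves coset_act (H_gen r0 r1 g) (cspan (E_space D) {v})"
    if "v \<in> carrier_vec n" "G g *\<^sub>v v = x \<cdot>\<^sub>v v" for g v x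
    unfolding E_space_def
    by (rule preserves_span) (use that V.in_own_span[of "{v}"] in \<open>auto intro!: V.smult_in_span\<close>)
  have preserves_plane: "preserves coset_act (H_gen r0 r1 g) (cspan (E_space D) {v, w})"
    if "v \<in> carrier_vec n" "w \<in> carrier_vec n"
      "G g *\<^sub>v v = x \<cdot>\<^sub>v v + y \<cdot>\<^sub>v w" "G g *\<^sub>v w = x' \<cdot>\<^sub>v v + y' \<cdot>\<^sub>v w" for g v w x y x' y'
    unfolding E_space_def
    by (rule preserves_span) (use that comb in auto)
  have T1_plane: "preserves coset_act (H_gen r0 r1 T1) (cspan (E_space D) {b i, a (i + 1)})"
    if "i \<in> {0..D-1}" for i
    using T1_mult(1,2)[OF that]
    by (intro preserves_plane[of "b i" "a (i + 1)" T1 _ _ "s i" 0]) auto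
  have T0_plane: "preserves coset_act (H_gen r0 r1 T0) (cspan (E_space D) {a i, b i})"
    if "i \<in> {1..D-1}" for i
    by (rule preserves_plane[OF a_carrier b_carrier T0_mult(3,4)]) (use that in auto)
  have module: "H_module r0 r1 (E_space D) coset_act"
    unfolding E_space_def by (rule H_module_coset_act)
  have basis: "vectorspace.fin_dim class_ring (E_space D)"
    "vectorspace.dim class_ring (E_space D) = n"
    "vectorspace.basis class_ring (E_space D) (set (E_basis D))"
    unfolding E_space_def E_basis_def
    by (simp_all only: V.fin_dim V.dim_is_n V.unit_vecs_basis)
  have "length (E_basis D) = n" "distinct (E_basis D)"
    by (simp_all add: E_basis_def V.unit_vecs_distinct)
  moreover have "E_basis D ! (2 * (i + 1) - 1) = a (i + 1)" if "i \<in> {0..D-1}" for i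
    by (rule a_nth) (use that D_pos in auto)
  moreover have "E_basis D ! (2 * i - 1) = a i" if "i \<in> {1..D-1}" for i
    by (rule a_nth) (use that in auto)
  moreover have "E_basis D ! 0 = b 0"
    using b_nth[of 0] by simp
  ultimately show ?thesis
    unfolding adapted_block_basis_def Let_def E_act_eq
    using D_pos module basis a_nth b_nth lam_ext_nonzero mu a_weight b_weight
      preserves_line[OF b_carrier T0_mult(1)] preserves_line[OF a_carrier T0_mult(2)]
      T0_plane T1_plane
    by (intro conjI exI2 ballI) simp_all
qed

end

theorem proposition3p4:
  fixes D :: nat and r0 r1 \<rho>m \<rho>p :: complex
    and c s lam mu :: "nat \<Rightarrow> complex"
  assumes "D \<ge> 1"
    and "r0 \<noteq> 0" and "r1 \<noteq> 0"
    and "\<rho>m \<in> {r0, inverse r0}" and "\<rho>p \<in> {r0, inverse r0}"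
    and "\<And>i. i \<in> {1..D-1} \<Longrightarrow> c i \<noteq> 0"
    and "\<And>i. i \<in> {0..D-1} \<Longrightarrow> s i \<noteq> 0"
    and "\<And>i. i \<in> {1..D-1} \<Longrightarrow> lam i \<noteq> 0"
    and "\<And>i. i \<in> {0..D-1} \<Longrightarrow> mu i \<noteq> 0"
  shows "adapted_block_basis r0 r1 (E_space D) (E_act r0 r1 D \<rho>m \<rho>p c s lam mu) D (E_basis D)"
proof -
  interpret E_parameters D r0 r1 \<rho>m \<rho>p c s lam mu
    by unfold_locales (use assms in auto)
  show ?thesis by (rule adapted_block_basis_E)
qed

end
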